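(* Let $d\ge 2$ be an integer and let $\mathcal{G}=(V;\varphi)$ be a $d$-graph with chromatic components $G_i=(V,E_i)$, $i\in[d]$. Then $\mathcal{G}$ is CIS if and only if $\mathcal{G}$ is Gallai and every $G_i$ is an ordinary CIS graph.
   Context: All graphs are finite and simple, and maximality is with respect to inclusion. For a graph $H=(W,F)$, a set $S\subseteq W$ is stable (independent) if no edge of $F$ has both ends in $S$. A graph is an ordinary CIS graph if each of its maximal cliques has nonempty intersection with each of its maximal stable sets. For an integer $d\ge 2$, write $[d]=\{1,\ldots,d\}$. A $d$-graph is a pair $\mathcal{G}=(V;\varphi)$, where $V$ is a finite vertex set and $\varphi:\binom{V}{2}\to[d]$ is a coloring of the edges of the complete graph on $V$; not every color need be used. For $i\in[d]$, the $i$-th chromatic component is the graph $G_i=(V,E_i)$ with $E_i=\varphi^{-1}(i)$. The $d$-graph $\mathcal{G}$ is CIS if for every choice of a maximal stable set $S_i$ of $G_i$, one for each $i\in[d]$, one has $\bigcap_{i=1}^d S_i\neq\varnothing$. The $d$-graph $\mathcal{G}$ is Gallai if it contains no rainbow triangle, that is, no three distinct vertices whose three connecting edges have pairwise distinct colors. *)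

theory Defs
  imports "HOL-Library.Ramsey"
begin

text \<open>
  A finite simple graph is given by a finite vertex set \<open>V\<close> and an edge set \<open>E \<subseteq> [V]\<^bsup>2\<^esup>\<close>, where
  \<open>[V]\<^bsup>2\<^esup>\<close> (the constant \<open>nsets\<close>) is the set of 2-element subsets of \<open>V\<close>.
  The predicates \<open>clique\<close> and \<open>indep\<close> are those of \<^theory>\<open>HOL-Library.Ramsey\<close>; their first argument
  is the clique or stable set itself, not the ambient vertex set.
\<close>

definition max_clique :: "'a set \<Rightarrow> 'a set set \<Rightarrow> 'a set \<Rightarrow> bool" where
  "max_clique V E C \<longleftrightarrow>
     C \<subseteq> V \<and> clique C E \<and> \<not> (\<exists>D. D \<subseteq> V \<and> clique D E \<and> C \<subset> D)"

definition max_stable :: "'a set \<Rightarrow> 'a set set \<Rightarrow> 'a set \<Rightarrow> bool" where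
  "max_stable V E S \<longleftrightarrow>
     S \<subseteq> V \<and> indep S E \<and> \<not> (\<exists>T. T \<subseteq> V \<and> indep T E \<and> S \<subset> T)"

definition CIS_graph :: "'a set \<Rightarrow> 'a set set \<Rightarrow> bool" where
  "CIS_graph V E \<longleftrightarrow> (\<forall>C S. max_clique V E C \<and> max_stable V E S \<longrightarrow> C \<inter> S \<noteq> {})"

text \<open>The values of the coloring \<open>\<phi>\<close> outside \<open>[V]\<^bsup>2\<^esup>\<close> are irrelevant.\<close>

definition d_graph :: "nat \<Rightarrow> 'a set \<Rightarrow> ('a set \<Rightarrow> nat) \<Rightarrow> bool" where
  "d_graph d V \<phi> \<longleftrightarrow> finite V \<and> \<phi> \<in> [V]\<^bsup>2\<^esup> \<rightarrow> {1..d}"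

definition component_edges :: "'a set \<Rightarrow> ('a set \<Rightarrow> nat) \<Rightarrow> nat \<Rightarrow> 'a set set" where
  "component_edges V \<phi> i = {e \<in> [V]\<^bsup>2\<^esup>. \<phi> e = i}"

definition CIS_d_graph :: "nat \<Rightarrow> 'a set \<Rightarrow> ('a set \<Rightarrow> nat) \<Rightarrow> bool" where
  "CIS_d_graph d V \<phi> \<longleftrightarrow>
     (\<forall>S :: nat \<Rightarrow> 'a set. (\<forall>i\<in>{1..d}. max_stable V (component_edges V \<phi> i) (S i)) \<longrightarrow>
        (\<Inter>i\<in>{1..d}. S i) \<noteq> {})"

definition rainbow_triangle :: "('a set \<Rightarrow> nat) \<Rightarrow> 'a \<Rightarrow> 'a \<Rightarrow> 'a \<Rightarrow> bool" where
  "rainbow_triangle \<phi> x y z \<longleftrightarrow>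
     x \<noteq> y \<and> y \<noteq> z \<and> x \<noteq> z \<and>
     \<phi> {x, y} \<noteq> \<phi> {y, z} \<and> \<phi> {y, z} \<noteq> \<phi> {x, z} \<and> \<phi> {x, y} \<noteq> \<phi> {x, z}"

definition gallai :: "'a set \<Rightarrow> ('a set \<Rightarrow> nat) \<Rightarrow> bool" where
  "gallai V \<phi> \<longleftrightarrow> \<not> (\<exists>x\<in>V. \<exists>y\<in>V. \<exists>z\<in>V. rainbow_triangle \<phi> x y z)"

end

theory Submission
  imports Defs
begin

text \<open>
  The two implications have unrelated proofs.

  \<^bold>\<open>A CIS colouring is Gallai.\<close> Take a counterexample with as few vertices as possible. Deleting
  all \<open>i\<close>-neighbours of one vertex preserves the CIS property (\<open>CIS_delete_neighbours\<close>), so the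
  deletion must destroy every rainbow triangle as soon as it deletes something. Apply this to a
  vertex \<open>a\<close> of a rainbow triangle \<open>abc\<close> and to the colour of the opposite edge \<open>bc\<close>: the triangle
  survives, so \<open>a\<close> has no incident edge of that colour at all. On the other hand, choosing maximal
  stable sets that contain suitable edges of the triangle gives two vertices \<open>v\<close> and \<open>w\<close> such that
  the edges from \<open>v\<close> to \<open>a, b, c\<close> have the colours of \<open>ac, ab, bc\<close> and those from \<open>w\<close> have the
  colours of \<open>ab, bc, ac\<close> (\<open>CIS_settles_rainbow_triangle\<close>). The edge \<open>vw\<close> completes at least one
  of the paths \<open>vaw\<close>, \<open>vbw\<close>, \<open>vcw\<close> to a rainbow triangle, whatever its colour. In that triangle the
  edge opposite \<open>v\<close> has a colour that also occurs on an edge from \<open>v\<close> to the original triangle,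
  which was just excluded.

  \<^bold>\<open>A Gallai colouring with CIS components is CIS.\<close> In a Gallai colouring every connected component
  of a chromatic component is a module: a vertex outside sees all of it in one colour. If some
  component is neither a single vertex nor everything, the hypotheses pass to that module and to
  the quotient in which it is contracted to one vertex, and the CIS property of both is put together
  again (\<open>CIS_graph_module\<close>, \<open>CIS_graph_quotient\<close>, \<open>CIS_d_graph_substitution\<close>). Otherwise every
  colour that occurs is connected and spanning. Three such colours cannot coexist
  (\<open>gallai_connected_colours\<close>), so at most two colours occur, and for two colours the claim is the
  CIS property of one component.
\<close>

section \<open>Maximal free sets\<close>

text \<open>
  With \<open>R x y\<close> saying that \<open>xy\<close> has colour \<open>i\<close> the free sets are the stable sets of the \<open>i\<close>-th
  chromatic component; with the complementary relation they are its cliques. Both kinds of sets are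
  treated at once in this way. Only distinct vertices are compared, so the values that a colouring
  takes on singletons do not matter.
\<close>

definition free :: "('a \<Rightarrow> 'a \<Rightarrow> bool) \<Rightarrow> 'a set \<Rightarrow> bool" where
  "free R S \<longleftrightarrow> (\<forall>x\<in>S. \<forall>y\<in>S. x \<noteq> y \<longrightarrow> \<not> R x y)"

definition max_free :: "'a set \<Rightarrow> ('a \<Rightarrow> 'a \<Rightarrow> bool) \<Rightarrow> 'a set \<Rightarrow> bool" where
  "max_free V R S \<longleftrightarrow> S \<subseteq> V \<and> free R S \<and> (\<forall>v\<in>V - S. \<exists>s\<in>S. R v s)"

lemma max_free_iff_maximal:
  assumes sym: "symp R"
  shows "max_free V R S \<longleftrightarrow> S \<subseteq> V \<and> free R S \<and> \<not> (\<exists>T. T \<subseteq> V \<and> free R T \<and> S \<subset> T)"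
proof -
  have key: "(\<exists>T. T \<subseteq> V \<and> free R T \<and> S \<subset> T) \<longleftrightarrow> \<not> (\<forall>v\<in>V - S. \<exists>s\<in>S. R v s)"
    if S: "S \<subseteq> V" "free R S"
  proof
    assume "\<exists>T. T \<subseteq> V \<and> free R T \<and> S \<subset> T"
    then obtain T v where T: "T \<subseteq> V" "free R T" "S \<subset> T" "v \<in> T - S" by blast
    then have "v \<in> V - S" by blast
    moreover have "\<not> R v s" if "s \<in> S" for s
    proof -
      have "s \<in> T" "v \<in> T" "v \<noteq> s" using T that by auto
      then show ?thesis using T(2) by (simp add: free_def)
    qed
    ultimately show "\<not> (\<forall>v\<in>V - S. \<exists>s\<in>S. R v s)" by blast
  next
    assume "\<not> (\<forall>v\<in>V - S. \<exists>s\<in>S. R v s)"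
    then obtain v where v: "v \<in> V - S" "\<forall>s\<in>S. \<not> R v s" by blast
    then have "free R (insert v S)"
      using S unfolding free_def by (metis insertE sympD[OF sym])
    then show "\<exists>T. T \<subseteq> V \<and> free R T \<and> S \<subset> T"
      using v S by (intro exI[of _ "insert v S"]) auto
  qed
  show ?thesis
    unfolding max_free_def by (intro conj_cong refl) (simp only: key simp_thms)
qed

lemma max_free_extend:
  assumes "finite V" "A \<subseteq> V" "free R A" "symp R"
  obtains S where "max_free V R S" "A \<subseteq> S"
proof -
  define F where "F = {S. S \<subseteq> V \<and> free R S}"
  have "finite F" "A \<in> F"
    using assms by (auto simp: F_def)
  then obtain S where "S \<in> F" "A \<subseteq> S" "\<And>T. T \<in> F \<Longrightarrow> S \<subseteq> T \<Longrightarrow> T = S"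
    by (metis finite_has_maximal2)
  then have "max_free V R S"
    unfolding max_free_iff_maximal[OF \<open>symp R\<close>] F_def by blast
  then show thesis
    using that \<open>A \<subseteq> S\<close> by blast
qed

lemma symp_colour: "symp (\<lambda>x y. \<phi> {x, y} = c)" "symp (\<lambda>x y. \<phi> {x, y} \<noteq> c)"
  by (simp_all add: symp_def insert_commute)

lemma max_stable_iff_max_free:
  "max_stable V (component_edges V \<phi> i) S \<longleftrightarrow> max_free V (\<lambda>x y. \<phi> {x, y} = i) S"
proof -
  have "indep T (component_edges V \<phi> i) \<longleftrightarrow> free (\<lambda>x y. \<phi> {x, y} = i) T" if "T \<subseteq> V" for T
    using that unfolding indep_def component_edges_def free_def
    by (auto simp: doubleton_in_nsets_2 subset_iff)
  then show ?thesis
    by (simp add: max_stable_def max_free_iff_maximal[OF symp_colour(1)] cong: conj_cong)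
qed

lemma max_clique_iff_max_free:
  "max_clique V (component_edges V \<phi> i) C \<longleftrightarrow> max_free V (\<lambda>x y. \<phi> {x, y} \<noteq> i) C"
proof -
  have "clique T (component_edges V \<phi> i) \<longleftrightarrow> free (\<lambda>x y. \<phi> {x, y} \<noteq> i) T" if "T \<subseteq> V" for T
    using that unfolding clique_def component_edges_def free_def
    by (auto simp: doubleton_in_nsets_2 subset_iff)
  then show ?thesis
    by (simp add: max_clique_def max_free_iff_maximal[OF symp_colour(2)] cong: conj_cong)
qed

lemma CIS_graph_iff:
  "CIS_graph V (component_edges V \<phi> i) \<longleftrightarrow>
    (\<forall>C S. max_free V (\<lambda>x y. \<phi> {x, y} \<noteq> i) C \<longrightarrow> max_free V (\<lambda>x y. \<phi> {x, y} = i) S \<longrightarrow> C \<inter> S \<noteq> {})"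
  by (simp only: CIS_graph_def max_stable_iff_max_free max_clique_iff_max_free imp_conjL)

lemma CIS_d_graph_iff:
  "CIS_d_graph d V \<phi> \<longleftrightarrow>
    (\<forall>S. (\<forall>i\<in>{1..d}. max_free V (\<lambda>x y. \<phi> {x, y} = i) (S i)) \<longrightarrow> (\<Inter>i\<in>{1..d}. S i) \<noteq> {})"
  by (simp add: CIS_d_graph_def max_stable_iff_max_free)

text \<open>
  The form in which the CIS property is used: partial stable sets \<open>A i\<close> are extended to maximal ones,
  and the common vertex of these has no \<open>i\<close>-neighbour in \<open>A i\<close>. In short, the \<open>i\<close>-neighbourhoods of
  stable sets \<open>A i\<close> never cover all vertices.
\<close>

lemma CIS_d_graph_avoiding_vertex:
  assumes cis: "CIS_d_graph d V \<phi>" and "finite V" "d \<ge> 1"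
    and A: "\<forall>i\<in>{1..d}. A i \<subseteq> V \<and> free (\<lambda>x y. \<phi> {x, y} = i) (A i)"
  shows "\<exists>v\<in>V. \<forall>i\<in>{1..d}. \<forall>x\<in>A i. x \<noteq> v \<longrightarrow> \<phi> {v, x} \<noteq> i"
proof -
  have "\<forall>i\<in>{1..d}. \<exists>T. max_free V (\<lambda>x y. \<phi> {x, y} = i) T \<and> A i \<subseteq> T"
    using max_free_extend[OF \<open>finite V\<close> _ _ symp_colour(1)] A by metis
  then obtain S where S: "\<forall>i\<in>{1..d}. max_free V (\<lambda>x y. \<phi> {x, y} = i) (S i) \<and> A i \<subseteq> S i"
    by metis
  then have "(\<Inter>i\<in>{1..d}. S i) \<noteq> {}"
    using cis by (simp add: CIS_d_graph_iff)
  then obtain v where v: "\<forall>i\<in>{1..d}. v \<in> S i"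
    by blast
  have "v \<in> V"
    using S v \<open>d \<ge> 1\<close> by (force simp: max_free_def)
  moreover have "\<forall>x\<in>A i. x \<noteq> v \<longrightarrow> \<phi> {v, x} \<noteq> i" if "i \<in> {1..d}" for i
    using S v that unfolding max_free_def free_def by (metis subsetD)
  ultimately show ?thesis by blast
qed

lemma colour_in_range:
  assumes "d_graph d V \<phi>" "x \<in> V" "y \<in> V" "x \<noteq> y"
  shows "\<phi> {x, y} \<in> {1..d}"
  using assms by (auto simp: d_graph_def Pi_iff doubleton_in_nsets_2)

lemma d_graph_subset: "d_graph d V \<phi> \<Longrightarrow> U \<subseteq> V \<Longrightarrow> d_graph d U \<phi>"
  unfolding d_graph_def using nsets_mono[of U V 2] by (auto intro: finite_subset)

section \<open>CIS colourings are Gallai\<close>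

text \<open>
  A clique of colour \<open>i\<close> is stable in every other colour, so it can serve as \<open>A j\<close> for all \<open>j \<noteq> i\<close>.
\<close>

lemma CIS_component:
  assumes cis: "CIS_d_graph d V \<phi>" and dg: "d_graph d V \<phi>" and i: "i \<in> {1..d}"
  shows "CIS_graph V (component_edges V \<phi> i)"
  unfolding CIS_graph_iff
proof (intro allI impI)
  fix C S
  assume C: "max_free V (\<lambda>x y. \<phi> {x, y} \<noteq> i) C" and S: "max_free V (\<lambda>x y. \<phi> {x, y} = i) S"
  have fin: "finite V" "d \<ge> 1"
    using dg i by (auto simp: d_graph_def)
  have sub: "S \<subseteq> V" "C \<subseteq> V"
    using S C by (simp_all add: max_free_def)
  have "\<forall>j\<in>{1..d}. (if j = i then S else C) \<subseteq> V \<and>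
      free (\<lambda>x y. \<phi> {x, y} = j) (if j = i then S else C)"
    using C S by (auto simp: max_free_def free_def)
  from CIS_d_graph_avoiding_vertex[OF cis fin this]
  obtain v where v: "v \<in> V"
    and vA: "\<forall>j\<in>{1..d}. \<forall>x\<in>if j = i then S else C. x \<noteq> v \<longrightarrow> \<phi> {v, x} \<noteq> j" ..
  have vS: "\<phi> {v, x} \<noteq> i" if "x \<in> S" "x \<noteq> v" for x
    using bspec[OF vA i] that by simp
  have vC: "\<phi> {v, x} = i" if "x \<in> C" "x \<noteq> v" for x
  proof (rule ccontr)
    assume "\<phi> {v, x} \<noteq> i"
    moreover have "\<phi> {v, x} \<in> {1..d}"
      using colour_in_range[OF dg v, of x] that sub by blast
    ultimately have "\<forall>y\<in>C. y \<noteq> v \<longrightarrow> \<phi> {v, y} \<noteq> \<phi> {v, x}"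
      using bspec[OF vA, of "\<phi> {v, x}"] by simp
    then show False
      using that by blast
  qed
  have "v \<in> S"
    using vS S v unfolding max_free_def by (metis DiffI)
  moreover have "v \<in> C"
    using vC C v unfolding max_free_def by (metis DiffI)
  ultimately show "C \<inter> S \<noteq> {}" by blast
qed

text \<open>
  The vertex \<open>x\<close> is isolated in colour \<open>i\<close> after the deletion, hence lies in each maximal stable set
  of that colour. Extending the stable sets to the original graph therefore yields a common vertex
  that is not an \<open>i\<close>-neighbour of \<open>x\<close>, that is, one that was not deleted.
\<close>

lemma CIS_delete_neighbours:
  assumes cis: "CIS_d_graph d V \<phi>" and dg: "d_graph d V \<phi>" and i: "i \<in> {1..d}" and x: "x \<in> V"
  shows "CIS_d_graph d {y \<in> V. y = x \<or> \<phi> {x, y} \<noteq> i} \<phi>"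
  unfolding CIS_d_graph_iff
proof (intro allI impI)
  define U where "U = {y \<in> V. y = x \<or> \<phi> {x, y} \<noteq> i}"
  fix T
  assume "\<forall>j\<in>{1..d}. max_free {y \<in> V. y = x \<or> \<phi> {x, y} \<noteq> i} (\<lambda>x y. \<phi> {x, y} = j) (T j)"
  then have T: "\<forall>j\<in>{1..d}. max_free U (\<lambda>x y. \<phi> {x, y} = j) (T j)"
    by (simp add: U_def)
  have fin: "finite V" "d \<ge> 1"
    using dg i by (auto simp: d_graph_def)
  have "\<forall>j\<in>{1..d}. T j \<subseteq> V \<and> free (\<lambda>x y. \<phi> {x, y} = j) (T j)"
    using T by (auto simp: max_free_def U_def)
  from CIS_d_graph_avoiding_vertex[OF cis fin this]
  obtain v where v: "v \<in> V" "\<forall>j\<in>{1..d}. \<forall>y\<in>T j. y \<noteq> v \<longrightarrow> \<phi> {v, y} \<noteq> j" ..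
  have "x \<in> T i"
  proof (rule ccontr)
    assume "x \<notin> T i"
    moreover have "x \<in> U" "max_free U (\<lambda>x y. \<phi> {x, y} = i) (T i)"
      using x T i by (auto simp: U_def)
    ultimately obtain y where "y \<in> T i" "\<phi> {x, y} = i" "y \<in> U" "y \<noteq> x"
      unfolding max_free_def by blast
    then show False by (auto simp: U_def)
  qed
  then have "v = x \<or> \<phi> {v, x} \<noteq> i"
    using bspec[OF bspec[OF v(2) i]] by metis
  then have "v \<in> U"
    using v(1) by (auto simp: U_def insert_commute)
  then have "v \<in> T j" if "j \<in> {1..d}" for j
    using bspec[OF T that] bspec[OF v(2) that] unfolding max_free_def by (metis DiffI)
  then show "(\<Inter>j\<in>{1..d}. T j) \<noteq> {}" by blast
qed

text \<open>
  Every pair of vertices of the triangle is stable in every colour but its own. Giving the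
  three colours the three different pairs below excludes all three vertices of the triangle from the
  intersection and leaves each edge from the common vertex to the triangle a single possible colour.
  Exchanging \<open>b\<close> and \<open>c\<close> rotates the three colours seen from the common vertex the other way.
\<close>

lemma CIS_settles_rainbow_triangle:
  assumes cis: "CIS_d_graph d V \<phi>" and dg: "d_graph d V \<phi>"
    and V: "a \<in> V" "b \<in> V" "c \<in> V" and rb: "rainbow_triangle \<phi> a b c"
  obtains v where "v \<in> V" "v \<noteq> a" "v \<noteq> b" "v \<noteq> c"
    "\<phi> {v, a} = \<phi> {a, c}" "\<phi> {v, b} = \<phi> {a, b}" "\<phi> {v, c} = \<phi> {b, c}"
proof -
  define i j k where "i = \<phi> {b, c}" and "j = \<phi> {a, c}" and "k = \<phi> {a, b}"
  have col: "\<phi> {b, c} = i" "\<phi> {c, b} = i" "\<phi> {a, c} = j" "\<phi> {c, a} = j"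
      "\<phi> {a, b} = k" "\<phi> {b, a} = k"
    by (simp_all add: i_def j_def k_def insert_commute)
  have ne: "a \<noteq> b" "b \<noteq> c" "a \<noteq> c" "i \<noteq> j" "i \<noteq> k" "j \<noteq> k"
    using rb by (auto simp: rainbow_triangle_def col)
  have ijk: "i \<in> {1..d}" "j \<in> {1..d}" "k \<in> {1..d}"
    using colour_in_range[OF dg V(2,3) ne(2)] colour_in_range[OF dg V(1,3) ne(3)]
      colour_in_range[OF dg V(1,2) ne(1)] by (simp_all only: col)
  \<comment> \<open>Colours that do not occur on the triangle get all three vertices, so that they cannot occur on
    the edges from the common vertex either.\<close>
  define A where "A l = (if l = i then {a, b} else if l = j then {b, c} else if l = k then {a, c}
      else {a, b, c})" for l
  have fin: "finite V" "d \<ge> 1"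
    using dg ijk by (auto simp: d_graph_def)
  have "\<forall>l\<in>{1..d}. A l \<subseteq> V \<and> free (\<lambda>x y. \<phi> {x, y} = l) (A l)"
    using V ne by (simp add: A_def free_def col)
  from CIS_d_graph_avoiding_vertex[OF cis fin this]
  obtain v where v: "v \<in> V" "\<forall>l\<in>{1..d}. \<forall>x\<in>A l. x \<noteq> v \<longrightarrow> \<phi> {v, x} \<noteq> l" ..
  have "v \<noteq> a" using bspec[OF v(2) ijk(2)] ne col by (auto simp: A_def)
  moreover have "v \<noteq> b" using bspec[OF v(2) ijk(3)] ne col by (auto simp: A_def)
  moreover have "v \<noteq> c" using bspec[OF v(2) ijk(1)] ne col by (auto simp: A_def)
  moreover have "x \<notin> A (\<phi> {v, x})" if "x \<in> V" "v \<noteq> x" for x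
    using bspec[OF v(2) colour_in_range[OF dg v(1) that]] that(2) by metis
  ultimately have "v \<noteq> a" "v \<noteq> b" "v \<noteq> c"
      "a \<notin> A (\<phi> {v, a})" "b \<notin> A (\<phi> {v, b})" "c \<notin> A (\<phi> {v, c})"
    using V by blast+
  then show thesis
    using that[of v] v(1) by (simp add: A_def col split: if_splits)
qed

lemma CIS_d_graph_imp_gallai:
  assumes "CIS_d_graph d V \<phi>" "d_graph d V \<phi>"
  shows "gallai V \<phi>"
  using assms
proof (induction "card V" arbitrary: V rule: less_induct)
  case (less V)
  note cis = less.prems(1) and dg = less.prems(2)
  have fin: "finite V" using dg by (simp add: d_graph_def)
  \<comment> \<open>Otherwise deleting the neighbours of \<open>a\<close> in the colour of \<open>bc\<close> loses \<open>x\<close> but keeps \<open>a\<close>, \<open>b\<close>, \<open>c\<close>.\<close>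
  have opposite: "\<phi> {a, x} \<noteq> \<phi> {b, c}"
    if abc: "a \<in> V" "b \<in> V" "c \<in> V" "rainbow_triangle \<phi> a b c" and x: "x \<in> V" "x \<noteq> a" for a b c x
  proof
    assume eq: "\<phi> {a, x} = \<phi> {b, c}"
    define U where "U = {y \<in> V. y = a \<or> \<phi> {a, y} \<noteq> \<phi> {b, c}}"
    have "\<phi> {b, c} \<in> {1..d}"
      using dg abc by (intro colour_in_range) (auto simp: rainbow_triangle_def)
    then have "CIS_d_graph d U \<phi>"
      unfolding U_def using CIS_delete_neighbours[OF cis dg] abc by blast
    moreover have "d_graph d U \<phi>"
      using dg by (rule d_graph_subset) (auto simp: U_def)
    moreover have "card U < card V"
      using fin x eq by (intro psubset_card_mono) (auto simp: U_def)
    ultimately have "gallai U \<phi>"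
      by (rule less.hyps[rotated 1])
    moreover have "a \<in> U" "b \<in> U" "c \<in> U"
      using abc by (auto simp: U_def rainbow_triangle_def)
    ultimately show False
      using abc by (auto simp: gallai_def)
  qed
  show "gallai V \<phi>"
    unfolding gallai_def
  proof
    assume "\<exists>a\<in>V. \<exists>b\<in>V. \<exists>c\<in>V. rainbow_triangle \<phi> a b c"
    then obtain a b c where V: "a \<in> V" "b \<in> V" "c \<in> V" and rb: "rainbow_triangle \<phi> a b c" by blast
    have ne: "\<phi> {a, b} \<noteq> \<phi> {b, c}" "\<phi> {b, c} \<noteq> \<phi> {a, c}" "\<phi> {a, b} \<noteq> \<phi> {a, c}"
      using rb by (auto simp: rainbow_triangle_def)
    obtain v where v: "v \<in> V" "v \<noteq> a" "v \<noteq> b" "v \<noteq> c"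
        "\<phi> {v, a} = \<phi> {a, c}" "\<phi> {v, b} = \<phi> {a, b}" "\<phi> {v, c} = \<phi> {b, c}"
      using CIS_settles_rainbow_triangle[OF cis dg V rb] .
    have "rainbow_triangle \<phi> a c b"
      using rb by (auto simp: rainbow_triangle_def insert_commute)
    then obtain w where w': "w \<in> V" "w \<noteq> a" "w \<noteq> c" "w \<noteq> b"
        "\<phi> {w, a} = \<phi> {a, b}" "\<phi> {w, c} = \<phi> {a, c}" "\<phi> {w, b} = \<phi> {c, b}"
      by (rule CIS_settles_rainbow_triangle[OF cis dg V(1,3,2)])
    then have w: "w \<in> V" "a \<noteq> w" "b \<noteq> w" "c \<noteq> w"
        "\<phi> {a, w} = \<phi> {a, b}" "\<phi> {b, w} = \<phi> {b, c}" "\<phi> {c, w} = \<phi> {a, c}"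
      by (simp_all add: insert_commute)
    have "v \<noteq> w"
      using v(5) w'(5) ne(3) by auto
    \<comment> \<open>The edge from \<open>v\<close> to \<open>y\<close> has the colour of the edge opposite to \<open>v\<close>. Such a vertex \<open>y\<close> exists
      for each of \<open>x = a\<close>, \<open>b\<close>, \<open>c\<close>, namely \<open>b\<close>, \<open>c\<close>, \<open>a\<close>.\<close>
    have no_rainbow: "\<not> rainbow_triangle \<phi> v x w"
      if "x \<in> V" "y \<in> V" "v \<noteq> y" "\<phi> {v, y} = \<phi> {x, w}" for x y
      using opposite[of v x w y] v(1) w(1) that by auto
    have "\<not> rainbow_triangle \<phi> v a w" "\<not> rainbow_triangle \<phi> v b w" "\<not> rainbow_triangle \<phi> v c w"
      using no_rainbow[of a b] no_rainbow[of b c] no_rainbow[of c a] V v w by auto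
    \<comment> \<open>The pairs \<open>{va, aw}\<close>, \<open>{vb, bw}\<close>, \<open>{vc, cw}\<close> carry the three different pairs of colours of the
      triangle, so \<open>vw\<close> would need a colour that lies in all three pairs.\<close>
    then show False
      unfolding rainbow_triangle_def using v(2-) w(2-) ne \<open>v \<noteq> w\<close> by metis
  qed
qed

section \<open>Modules\<close>

definition module :: "'a set \<Rightarrow> ('a \<Rightarrow> 'a \<Rightarrow> bool) \<Rightarrow> 'a set \<Rightarrow> bool" where
  "module V R M \<longleftrightarrow> M \<subseteq> V \<and> (\<forall>x\<in>V - M. \<forall>y\<in>M. \<forall>z\<in>M. R x y \<longrightarrow> R x z)"

text \<open>
  A vertex outside the module that dominates one vertex of it dominates all of it, so it cannot
  belong to a free set that meets the module.
\<close>

lemma max_free_restrict: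
  assumes "max_free V R S" "module V R M" "symp R" "S \<inter> M \<noteq> {}"
  shows "max_free M R (S \<inter> M)"
  unfolding max_free_def
proof (intro conjI ballI)
  show "free R (S \<inter> M)"
    using assms(1) by (auto simp: max_free_def free_def)
  fix v assume v: "v \<in> M - S \<inter> M"
  then have "v \<in> V - S"
    using assms(2) by (auto simp: module_def)
  then obtain s where s: "s \<in> S" "R v s" "s \<in> V"
    using assms(1) unfolding max_free_def by blast
  obtain m where m: "m \<in> S" "m \<in> M"
    using assms(4) by blast
  have "s \<in> M"
  proof (rule ccontr)
    assume "s \<notin> M"
    have "R s v"
      using s(2) by (rule sympD[OF assms(3)])
    then have "R s m" "s \<noteq> m"
      using assms(2) s v m \<open>s \<notin> M\<close> unfolding module_def by blast+
    then show False
      using assms(1) s m by (auto simp: max_free_def free_def)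
  qed
  then show "\<exists>s\<in>S \<inter> M. R v s"
    using s by blast
qed simp

text \<open>
  The quotient by a module \<open>M\<close> is represented by the subgraph on \<open>insert m (V - M)\<close>, with \<open>m \<in> M\<close>
  standing for the whole module. Maximal free sets pass to the quotient, and conversely \<open>m\<close> can be
  replaced by any maximal free set of \<open>M\<close>.
\<close>

lemma max_free_contract:
  assumes S: "max_free V R S" and M: "module V R M" "m \<in> M" and sym: "symp R"
  shows "max_free (insert m (V - M)) R (if S \<inter> M = {} then S else insert m (S - M))"
proof (cases "S \<inter> M = {}")
  case True
  then show ?thesis
    using S M by (auto simp: max_free_def module_def)
next
  case False
  then obtain t where t: "t \<in> S" "t \<in> M" by blast
  have mod: "R x y \<longleftrightarrow> R x z" if "x \<in> V - M" "y \<in> M" "z \<in> M" for x y z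
    using M that unfolding module_def by blast
  have free: "\<And>x y. x \<in> S \<Longrightarrow> y \<in> S \<Longrightarrow> x \<noteq> y \<Longrightarrow> \<not> R x y"
    and dom: "\<And>x. x \<in> V - S \<Longrightarrow> \<exists>s\<in>S. R x s" and sub: "S \<subseteq> V"
    using S by (auto simp: max_free_def free_def)
  have sym': "R x y \<longleftrightarrow> R y x" for x y
    using sympD[OF sym] by blast
  have nm: "\<not> R x m \<and> \<not> R m x" if "x \<in> S - M" for x
    using that mod[of x m t] free[of x t] t sub M(2) sym' by blast
  have "free R (insert m (S - M))"
    using free nm unfolding free_def by blast
  moreover have "\<exists>s\<in>insert m (S - M). R v s" if "v \<in> insert m (V - M) - insert m (S - M)" for v
  proof -
    have "v \<in> V - S" "v \<in> V - M" using that by auto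
    then obtain s where "s \<in> S" "R v s" using dom by blast
    then show ?thesis
      using mod[OF \<open>v \<in> V - M\<close>, of s m] M(2) by (cases "s \<in> M") auto
  qed
  ultimately show ?thesis
    using False sub by (auto simp: max_free_def)
qed

lemma max_free_expand:
  assumes S: "max_free (insert m (V - M)) R S" and M: "module V R M" "m \<in> M" and sym: "symp R"
    and T: "max_free M R T"
  shows "max_free V R (if m \<in> S then S - {m} \<union> T else S)"
proof -
  have mod: "R x y \<longleftrightarrow> R x z" if "x \<in> V - M" "y \<in> M" "z \<in> M" for x y z
    using M that unfolding module_def by blast
  have sym': "R x y \<longleftrightarrow> R y x" for x y
    using sympD[OF sym] by blast
  have free: "\<And>x y. x \<in> S \<Longrightarrow> y \<in> S \<Longrightarrow> x \<noteq> y \<Longrightarrow> \<not> R x y"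
    and dom: "\<And>x. x \<in> insert m (V - M) - S \<Longrightarrow> \<exists>s\<in>S. R x s" and sub: "S \<subseteq> insert m (V - M)"
    using S by (auto simp: max_free_def free_def)
  have freeT: "\<And>x y. x \<in> T \<Longrightarrow> y \<in> T \<Longrightarrow> x \<noteq> y \<Longrightarrow> \<not> R x y"
    and domT: "\<And>x. x \<in> M - T \<Longrightarrow> \<exists>s\<in>T. R x s" and subT: "T \<subseteq> M"
    using T by (auto simp: max_free_def free_def)
  have MV: "M \<subseteq> V" using M by (simp add: module_def)
  show ?thesis
  proof (cases "m \<in> S")
    case True
    obtain t where t: "t \<in> T" using domT M(2) by blast
    have nT: "\<not> R x y \<and> \<not> R y x" if "x \<in> S - {m}" "y \<in> T" for x y
    proof -
      have "x \<in> V - M" "\<not> R x m" using that sub free True by auto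
      then show ?thesis using mod[of x y m] that subT M(2) sym' by blast
    qed
    have "free R (S - {m} \<union> T)"
      using free freeT nT unfolding free_def by blast
    moreover have "\<exists>s\<in>S - {m} \<union> T. R v s" if "v \<in> V - (S - {m} \<union> T)" for v
    proof (cases "v \<in> M")
      case True
      then show ?thesis using domT that by auto
    next
      case False
      then have "v \<in> insert m (V - M) - S" "v \<in> V - M" using that M(2) by auto
      then obtain s where "s \<in> S" "R v s" using dom by blast
      then show ?thesis
        using mod[OF \<open>v \<in> V - M\<close>, of m t] M(2) t subT by (cases "s = m") auto
    qed
    ultimately show ?thesis
      using True sub subT MV M(2) by (auto simp: max_free_def)
  next
    case False
    obtain s where s: "s \<in> S" "R m s" using dom False by blast
    have "\<exists>s\<in>S. R v s" if "v \<in> V - S" for v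
    proof (cases "v \<in> M")
      case True
      have "s \<in> V - M" using s sub False by auto
      then show ?thesis using mod[of s m v] True M(2) s sym' by blast
    next
      case False
      then show ?thesis using dom that by auto
    qed
    then show ?thesis
      using False sub free by (auto simp: max_free_def free_def)
  qed
qed

definition colour_module :: "'a set \<Rightarrow> ('a set \<Rightarrow> nat) \<Rightarrow> 'a set \<Rightarrow> bool" where
  "colour_module V \<phi> M \<longleftrightarrow> M \<subseteq> V \<and> (\<forall>x\<in>V - M. \<forall>y\<in>M. \<forall>z\<in>M. \<phi> {x, y} = \<phi> {x, z})"

lemma colour_module_imp_module:
  assumes "colour_module V \<phi> M"
  shows "module V (\<lambda>x y. \<phi> {x, y} = i) M" "module V (\<lambda>x y. \<phi> {x, y} \<noteq> i) M"
  using assms unfolding colour_module_def module_def by metis+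

lemma CIS_graph_quotient:
  assumes cis: "CIS_graph V (component_edges V \<phi> i)" and fin: "finite V"
    and M: "colour_module V \<phi> M" "m \<in> M"
  shows "CIS_graph (insert m (V - M)) (component_edges (insert m (V - M)) \<phi> i)"
  unfolding CIS_graph_iff
proof (intro allI impI)
  fix C S
  assume C: "max_free (insert m (V - M)) (\<lambda>x y. \<phi> {x, y} \<noteq> i) C"
    and S: "max_free (insert m (V - M)) (\<lambda>x y. \<phi> {x, y} = i) S"
  have finM: "finite M" using fin M by (auto simp: colour_module_def intro: finite_subset)
  obtain C' where C': "max_free M (\<lambda>x y. \<phi> {x, y} \<noteq> i) C'"
    by (rule max_free_extend[OF finM _ _ symp_colour(2), of "{}" \<phi> i]) (simp_all add: free_def)
  obtain S' where S': "max_free M (\<lambda>x y. \<phi> {x, y} = i) S'"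
    by (rule max_free_extend[OF finM _ _ symp_colour(1), of "{}" \<phi> i]) (simp_all add: free_def)
  have "(if m \<in> C then C - {m} \<union> C' else C) \<inter> (if m \<in> S then S - {m} \<union> S' else S) \<noteq> {}"
    using cis max_free_expand[OF C colour_module_imp_module(2)[OF M(1)] M(2) symp_colour(2) C']
      max_free_expand[OF S colour_module_imp_module(1)[OF M(1)] M(2) symp_colour(1) S']
    unfolding CIS_graph_iff by blast
  moreover have "C \<subseteq> insert m (V - M)" "S \<subseteq> insert m (V - M)" "C' \<subseteq> M" "S' \<subseteq> M"
    using C S C' S' by (auto simp: max_free_def)
  ultimately show "C \<inter> S \<noteq> {}"
    by (auto split: if_splits)
qed

text \<open>
  A maximal clique and a maximal stable set of the module are completed to the whole graph by such
  sets of the quotient that both contain \<open>m\<close>. These meet in nothing but \<open>m\<close>, so the common vertex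
  promised by the CIS property lies in the module.
\<close>

lemma CIS_graph_module:
  assumes cis: "CIS_graph V (component_edges V \<phi> i)" and fin: "finite V"
    and M: "colour_module V \<phi> M" "m \<in> M"
  shows "CIS_graph M (component_edges M \<phi> i)"
  unfolding CIS_graph_iff
proof (intro allI impI)
  fix C S
  assume C: "max_free M (\<lambda>x y. \<phi> {x, y} \<noteq> i) C" and S: "max_free M (\<lambda>x y. \<phi> {x, y} = i) S"
  have finQ: "finite (insert m (V - M))" using fin by simp
  obtain C' where C': "max_free (insert m (V - M)) (\<lambda>x y. \<phi> {x, y} \<noteq> i) C'" "m \<in> C'"
    by (rule max_free_extend[OF finQ _ _ symp_colour(2), of "{m}" \<phi> i]) (simp_all add: free_def)
  obtain S' where S': "max_free (insert m (V - M)) (\<lambda>x y. \<phi> {x, y} = i) S'" "m \<in> S'"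
    by (rule max_free_extend[OF finQ _ _ symp_colour(1), of "{m}" \<phi> i]) (simp_all add: free_def)
  have "(C' - {m} \<union> C) \<inter> (S' - {m} \<union> S) \<noteq> {}"
    using cis max_free_expand[OF C'(1) colour_module_imp_module(2)[OF M(1)] M(2) symp_colour(2) C]
      max_free_expand[OF S'(1) colour_module_imp_module(1)[OF M(1)] M(2) symp_colour(1) S] C'(2) S'(2)
    unfolding CIS_graph_iff by auto
  moreover have "C' \<inter> S' \<subseteq> {m}"
    using C' S' unfolding max_free_def free_def by blast
  moreover have "C' \<subseteq> insert m (V - M)" "S' \<subseteq> insert m (V - M)" "C \<subseteq> M" "S \<subseteq> M"
    using C C' S S' by (auto simp: max_free_def)
  ultimately show "C \<inter> S \<noteq> {}" by blast
qed

text \<open>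
  A common vertex is searched in the quotient first; if it is the contracted module, then all the
  stable sets meet the module, and the search continues there.
\<close>

lemma CIS_d_graph_substitution:
  assumes M: "colour_module V \<phi> M" "m \<in> M"
    and cisM: "CIS_d_graph d M \<phi>" and cisQ: "CIS_d_graph d (insert m (V - M)) \<phi>"
  shows "CIS_d_graph d V \<phi>"
  unfolding CIS_d_graph_iff
proof (intro allI impI)
  fix S
  assume S: "\<forall>i\<in>{1..d}. max_free V (\<lambda>x y. \<phi> {x, y} = i) (S i)"
  define Q where "Q i = (if S i \<inter> M = {} then S i else insert m (S i - M))" for i
  have "max_free (insert m (V - M)) (\<lambda>x y. \<phi> {x, y} = i) (Q i)" if "i \<in> {1..d}" for i
    unfolding Q_def
    by (rule max_free_contract[OF bspec[OF S that] colour_module_imp_module(1)[OF M(1)] M(2) symp_colour(1)])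
  then have "(\<Inter>i\<in>{1..d}. Q i) \<noteq> {}"
    using cisQ by (simp add: CIS_d_graph_iff)
  then obtain x where x: "\<forall>i\<in>{1..d}. x \<in> Q i"
    by blast
  show "(\<Inter>i\<in>{1..d}. S i) \<noteq> {}"
  proof (cases "x = m")
    case True
    then have "S i \<inter> M \<noteq> {}" if "i \<in> {1..d}" for i
      using x M(2) that by (force simp: Q_def split: if_splits)
    then have "max_free M (\<lambda>x y. \<phi> {x, y} = i) (S i \<inter> M)" if "i \<in> {1..d}" for i
      using that by (intro max_free_restrict[OF bspec[OF S that]
        colour_module_imp_module(1)[OF M(1)] symp_colour(1)])
    then have "(\<Inter>i\<in>{1..d}. S i \<inter> M) \<noteq> {}"
      by (rule cisM[unfolded CIS_d_graph_iff, rule_format])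
    then show ?thesis by blast
  next
    case False
    then have "\<forall>i\<in>{1..d}. x \<in> S i"
      using x by (auto simp: Q_def split: if_splits)
    then show ?thesis by blast
  qed
qed

section \<open>Components of Gallai colourings\<close>

definition colour_rel :: "'a set \<Rightarrow> ('a set \<Rightarrow> nat) \<Rightarrow> nat \<Rightarrow> ('a \<times> 'a) set" where
  "colour_rel V \<phi> i = {(x, y). x \<in> V \<and> y \<in> V \<and> x \<noteq> y \<and> \<phi> {x, y} = i}"

definition colour_connected :: "'a set \<Rightarrow> ('a set \<Rightarrow> nat) \<Rightarrow> nat \<Rightarrow> bool" where
  "colour_connected V \<phi> i \<longleftrightarrow> (\<forall>x\<in>V. \<forall>y\<in>V. (x, y) \<in> (colour_rel V \<phi> i)\<^sup>*)"

lemma colour_rel_rtrancl_sym: "(x, y) \<in> (colour_rel V \<phi> i)\<^sup>* \<Longrightarrow> (y, x) \<in> (colour_rel V \<phi> i)\<^sup>*"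
  by (rule symD[OF sym_rtrancl]) (auto simp: sym_def colour_rel_def insert_commute)

lemma colour_rel_rtrancl_mem: "(x, y) \<in> (colour_rel V \<phi> i)\<^sup>* \<Longrightarrow> x \<in> V \<Longrightarrow> y \<in> V"
  by (induction rule: rtrancl_induct) (auto simp: colour_rel_def)

lemma gallai_subset: "gallai V \<phi> \<Longrightarrow> U \<subseteq> V \<Longrightarrow> gallai U \<phi>"
  unfolding gallai_def by blast

lemma gallai_triangle:
  assumes "gallai V \<phi>" "x \<in> V" "y \<in> V" "z \<in> V" "x \<noteq> y" "y \<noteq> z" "x \<noteq> z"
  shows "\<phi> {x, y} = \<phi> {y, z} \<or> \<phi> {y, z} = \<phi> {x, z} \<or> \<phi> {x, y} = \<phi> {x, z}"
  using assms by (auto simp: gallai_def rainbow_triangle_def)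

text \<open>
  Along an edge \<open>uw\<close> of colour \<open>i\<close> inside the component, neither \<open>xu\<close> nor \<open>xw\<close> has colour \<open>i\<close>; as
  the triangle is not rainbow, they have the same colour.
\<close>

lemma gallai_component_homogeneous:
  assumes g: "gallai V \<phi>" and x: "x \<in> V" "(y, x) \<notin> (colour_rel V \<phi> i)\<^sup>*" and y: "y \<in> V"
    and z: "(y, z) \<in> (colour_rel V \<phi> i)\<^sup>*"
  shows "\<phi> {x, z} = \<phi> {x, y}"
  using z
proof (induction rule: rtrancl_induct)
  case (step u w)
  have uw: "u \<in> V" "w \<in> V" "u \<noteq> w" "\<phi> {u, w} = i"
    using step(2) by (auto simp: colour_rel_def)
  have yw: "(y, w) \<in> (colour_rel V \<phi> i)\<^sup>*"
    using step by simp
  have "x \<noteq> u" "x \<noteq> w"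
    using x step(1) yw by auto
  moreover have "\<phi> {x, u} \<noteq> i" "\<phi> {x, w} \<noteq> i"
    using x uw \<open>x \<noteq> u\<close> \<open>x \<noteq> w\<close> step(1) yw
    by (auto simp: colour_rel_def insert_commute dest: rtrancl_into_rtrancl[where c = x])
  ultimately have "\<phi> {x, w} = \<phi> {x, u}"
    using gallai_triangle[OF g x(1) uw(1,2)] uw by auto
  then show ?case using step by simp
qed simp

lemma gallai_component_module:
  assumes "gallai V \<phi>" "x \<in> V"
  shows "colour_module V \<phi> ((colour_rel V \<phi> i)\<^sup>* `` {x})"
  unfolding colour_module_def
proof (intro conjI ballI)
  show "(colour_rel V \<phi> i)\<^sup>* `` {x} \<subseteq> V"
    using assms(2) by (auto dest: colour_rel_rtrancl_mem)
next
  fix u y z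
  assume u: "u \<in> V - (colour_rel V \<phi> i)\<^sup>* `` {x}"
    and yz: "y \<in> (colour_rel V \<phi> i)\<^sup>* `` {x}" "z \<in> (colour_rel V \<phi> i)\<^sup>* `` {x}"
  have "\<phi> {u, w} = \<phi> {u, x}" if "(x, w) \<in> (colour_rel V \<phi> i)\<^sup>*" for w
    by (rule gallai_component_homogeneous[OF assms(1) _ _ assms(2) that]) (use u in auto)
  then have "\<phi> {u, y} = \<phi> {u, x}" "\<phi> {u, z} = \<phi> {u, x}"
    using yz by blast+
  then show "\<phi> {u, y} = \<phi> {u, z}" by simp
qed

lemma path_to_vertex_last_step:
  assumes "(y, v) \<in> (colour_rel V \<phi> i)\<^sup>*" "y \<noteq> v" "y \<in> V"
  obtains p where "(y, p) \<in> (colour_rel (V - {v}) \<phi> i)\<^sup>*" "p \<in> V - {v}" "\<phi> {v, p} = i"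
proof -
  have "\<exists>p. (y, p) \<in> (colour_rel (V - {v}) \<phi> i)\<^sup>* \<and> p \<in> V - {v} \<and> \<phi> {v, p} = i"
    using assms
  proof (induction rule: converse_rtrancl_induct)
    case (step y z)
    have yz: "z \<in> V" "y \<noteq> z" "\<phi> {z, y} = i"
      using step(1) by (auto simp: colour_rel_def insert_commute)
    show ?case
    proof (cases "z = v")
      case True
      then show ?thesis using yz step.prems by (intro exI[of _ y]) simp
    next
      case False
      then obtain p where "(z, p) \<in> (colour_rel (V - {v}) \<phi> i)\<^sup>*" "p \<in> V - {v}" "\<phi> {v, p} = i"
        using step.IH yz(1) by blast
      moreover have "(y, z) \<in> colour_rel (V - {v}) \<phi> i"
        using step.prems yz False by (simp add: colour_rel_def insert_commute)
      ultimately show ?thesis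
        by (intro exI[of _ p]) (simp add: converse_rtrancl_into_rtrancl)
    qed
  qed simp
  then show thesis using that by blast
qed

lemma colour_connected_neighbour:
  assumes "colour_connected V \<phi> i" "v \<in> V" "y \<in> V" "y \<noteq> v"
  obtains p where "(y, p) \<in> (colour_rel (V - {v}) \<phi> i)\<^sup>*" "p \<in> V - {v}" "\<phi> {v, p} = i"
proof -
  have "(y, v) \<in> (colour_rel V \<phi> i)\<^sup>*"
    using assms by (simp add: colour_connected_def)
  then show thesis
    using that by (rule path_to_vertex_last_step[OF _ assms(4,3)])
qed

text \<open>
  Suppose colour \<open>i\<close> falls apart when \<open>v\<close> is deleted. Each of its components then contains an
  \<open>i\<close>-neighbour of \<open>v\<close>. If \<open>vx\<close> has colour \<open>j\<close>, then \<open>x\<close> sees such neighbours in other components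
  in colour \<open>j\<close>, because the triangle with \<open>v\<close> is not rainbow, and hence sees all of the other
  components in colour \<open>j\<close>. The same holds for a vertex \<open>z\<close> with \<open>vz\<close> of colour \<open>k\<close>. Whether \<open>x\<close> and
  \<open>z\<close> lie in the same component or not, some edge would get both colours \<open>j\<close> and \<open>k\<close>.
\<close>

lemma gallai_delete_vertex_connected:
  assumes g: "gallai V \<phi>" and v: "v \<in> V" and ij: "i \<noteq> j" "i \<noteq> k" "j \<noteq> k"
    and conn: "colour_connected V \<phi> i" "colour_connected V \<phi> j" "colour_connected V \<phi> k"
  shows "colour_connected (V - {v}) \<phi> i"
proof (rule ccontr)
  assume "\<not> ?thesis"
  then obtain s t where st: "s \<in> V - {v}" "t \<in> V - {v}"
      "(s, t) \<notin> (colour_rel (V - {v}) \<phi> i)\<^sup>*"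
    by (auto simp: colour_connected_def)
  define E where "E = (colour_rel (V - {v}) \<phi> i)\<^sup>*"
  have symE: "(x, y) \<in> E \<Longrightarrow> (y, x) \<in> E" for x y
    unfolding E_def by (rule colour_rel_rtrancl_sym)
  have transE: "(x, y) \<in> E \<Longrightarrow> (y, z) \<in> E \<Longrightarrow> (x, z) \<in> E" for x y z
    unfolding E_def by (rule rtrancl_trans)
  have g': "gallai (V - {v}) \<phi>" using g by (rule gallai_subset) auto
  have across: "\<phi> {x, y} = c"
    if "x \<in> V - {v}" "y \<in> V - {v}" "(x, y) \<notin> E" "\<phi> {v, x} = c" "\<phi> {v, y} = i" "c \<noteq> i" for x y c
  proof -
    have "x \<noteq> y" using that by auto
    moreover have "\<phi> {x, y} \<noteq> i"
      using that \<open>x \<noteq> y\<close> by (auto simp: E_def colour_rel_def)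
    ultimately show ?thesis
      using gallai_triangle[OF g v, of x y] that by auto
  qed
  obtain x where x: "x \<in> V - {v}" "\<phi> {v, x} = j"
    using colour_connected_neighbour[OF conn(2) v, of s] st by auto
  obtain z where z: "z \<in> V - {v}" "\<phi> {v, z} = k"
    using colour_connected_neighbour[OF conn(3) v, of s] st by auto
  have hom: "\<phi> {u, q} = \<phi> {u, y}"
    if "u \<in> V - {v}" "(y, u) \<notin> E" "y \<in> V - {v}" "(y, q) \<in> E" for u y q
    using gallai_component_homogeneous[OF g'] that unfolding E_def by blast
  \<comment> \<open>If \<open>x\<close> and \<open>z\<close> lie in the same component, both are compared with a vertex of another one;
    otherwise the edge \<open>xz\<close> itself is determined from both ends.\<close>
  show False
  proof (cases "(x, z) \<in> E")
    case True
    obtain y where y: "y \<in> V - {v}" "(x, y) \<notin> E"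
      using st symE transE unfolding E_def[symmetric] by blast
    obtain p where p: "(y, p) \<in> E" "p \<in> V - {v}" "\<phi> {v, p} = i"
      using colour_connected_neighbour[OF conn(1) v, of y] y unfolding E_def by auto
    have np: "(x, p) \<notin> E" "(z, p) \<notin> E"
      using True y p symE transE by blast+
    have "\<phi> {x, p} = j" "\<phi> {z, p} = k"
      using across[OF x(1) p(2) np(1) x(2) p(3)] across[OF z(1) p(2) np(2) z(2) p(3)] ij by auto
    moreover have "\<phi> {p, z} = \<phi> {p, x}"
      using hom[OF p(2) np(1) x(1) True] .
    ultimately show False
      using ij by (simp add: insert_commute)
  next
    case False
    obtain p where p: "(z, p) \<in> E" "p \<in> V - {v}" "\<phi> {v, p} = i"
      using colour_connected_neighbour[OF conn(1) v, of z] z unfolding E_def by auto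
    obtain q where q: "(x, q) \<in> E" "q \<in> V - {v}" "\<phi> {v, q} = i"
      using colour_connected_neighbour[OF conn(1) v, of x] x unfolding E_def by auto
    have n: "(x, p) \<notin> E" "(z, q) \<notin> E" "(z, x) \<notin> E"
      using False p q symE transE by blast+
    have "\<phi> {x, p} = j" "\<phi> {z, q} = k"
      using across[OF x(1) p(2) n(1) x(2) p(3)] across[OF z(1) q(2) n(2) z(2) q(3)] ij by auto
    moreover have "\<phi> {x, p} = \<phi> {x, z}"
      using hom[OF x(1) n(3) z(1) p(1)] .
    moreover have "\<phi> {z, q} = \<phi> {z, x}"
      using hom[OF z(1) False x(1) q(1)] .
    ultimately show False
      using ij by (simp add: insert_commute)
  qed
qed

text \<open>
  By the previous lemma vertices can be deleted until two are left, whose only edge has one colour.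
\<close>

lemma gallai_connected_colours:
  assumes "finite V" "card V \<ge> 2" "gallai V \<phi>" "i \<noteq> j" "i \<noteq> k" "j \<noteq> k"
    "colour_connected V \<phi> i" "colour_connected V \<phi> j" "colour_connected V \<phi> k"
  shows False
  using assms
proof (induction "card V" arbitrary: V rule: less_induct)
  case (less V)
  obtain v where v: "v \<in> V"
    using less.prems(2) by fastforce
  have conn: "colour_connected (V - {v}) \<phi> i" "colour_connected (V - {v}) \<phi> j"
      "colour_connected (V - {v}) \<phi> k"
    using gallai_delete_vertex_connected[OF less.prems(3) v less.prems(4-6,7-9)]
      gallai_delete_vertex_connected[OF less.prems(3) v less.prems(4)[symmetric] less.prems(6,5,8,7,9)]
      gallai_delete_vertex_connected[OF less.prems(3) v less.prems(5)[symmetric]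
        less.prems(6)[symmetric] less.prems(4,9,7,8)] by blast+
  have cV: "card V = Suc (card (V - {v}))"
    using less.prems(1) v by (metis card_Suc_Diff1)
  have "\<not> card (V - {v}) \<ge> 2"
    using less.hyps[of "V - {v}", OF _ _ _ _ less.prems(4-6) conn] less.prems(1) cV
      gallai_subset[OF less.prems(3), of "V - {v}"] by auto
  then have "card (V - {v}) = 1"
    using cV less.prems(2) by simp
  then obtain u where u: "V - {v} = {u}"
    by (auto simp: card_1_singleton_iff)
  have "\<phi> {v, u} = i" "\<phi> {v, u} = j"
    using colour_connected_neighbour[OF less.prems(7) v, of u] 
      colour_connected_neighbour[OF less.prems(8) v, of u] u by auto
  then show False using less.prems by simp
qed

section \<open>Gallai colourings with CIS components\<close>

text \<open>
  A maximal stable set of colour \<open>j\<close> is a maximal clique of colour \<open>i\<close>, and in a colour that does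
  not occur the only maximal stable set is the whole vertex set.
\<close>

lemma two_colours_CIS:
  assumes ij: "i \<in> {1..d}" "j \<in> {1..d}" "i \<noteq> j"
    and two: "\<And>x y. x \<in> V \<Longrightarrow> y \<in> V \<Longrightarrow> x \<noteq> y \<Longrightarrow> \<phi> {x, y} = i \<or> \<phi> {x, y} = j"
    and cis: "CIS_graph V (component_edges V \<phi> i)"
  shows "CIS_d_graph d V \<phi>"
  unfolding CIS_d_graph_iff
proof (intro allI impI)
  fix S
  assume S: "\<forall>l\<in>{1..d}. max_free V (\<lambda>x y. \<phi> {x, y} = l) (S l)"
  have "max_free V (\<lambda>x y. \<phi> {x, y} = j) (S j)"
    using S ij by blast
  then have "max_free V (\<lambda>x y. \<phi> {x, y} \<noteq> i) (S j)"
    using two ij(3) unfolding max_free_def free_def by (metis DiffD1 DiffD2 subsetD)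
  moreover have "max_free V (\<lambda>x y. \<phi> {x, y} = i) (S i)"
    using S ij by blast
  ultimately obtain x where x: "x \<in> S i" "x \<in> S j"
    using cis unfolding CIS_graph_iff by blast
  have "x \<in> S l" if l: "l \<in> {1..d}" for l
  proof (rule ccontr)
    assume n: "x \<notin> S l"
    have "max_free V (\<lambda>x y. \<phi> {x, y} = i) (S i)" "max_free V (\<lambda>x y. \<phi> {x, y} = l) (S l)"
      using S ij l by auto
    then obtain s where "x \<in> V" "s \<in> V" "s \<in> S l" "\<phi> {x, s} = l"
      using n x unfolding max_free_def by blast
    then show False
      using two[of x s] n x by auto
  qed
  then show "(\<Inter>l\<in>{1..d}. S l) \<noteq> {}" by blast
qed

lemma gallai_CIS_components_imp_CIS:
  assumes "d \<ge> 2" "d_graph d V \<phi>" "gallai V \<phi>"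
    "\<forall>i\<in>{1..d}. CIS_graph V (component_edges V \<phi> i)"
  shows "CIS_d_graph d V \<phi>"
  using assms
proof (induction "card V" arbitrary: V rule: less_induct)
  case (less V)
  note d = less.prems(1) and dg = less.prems(2) and g = less.prems(3) and cis = less.prems(4)
  have fin: "finite V" using dg by (simp add: d_graph_def)
  show ?case
  proof (cases "\<exists>i\<in>{1..d}. \<exists>x\<in>V. \<exists>y\<in>V. \<phi> {x, y} = i \<and> x \<noteq> y \<and> \<not> colour_connected V \<phi> i")
    case True
    then obtain i x y where xy: "x \<in> V" "y \<in> V" "\<phi> {x, y} = i" "x \<noteq> y"
      and nc: "\<not> colour_connected V \<phi> i" by blast
    \<comment> \<open>The component of \<open>x\<close> has at least the two vertices \<open>x\<close> and \<open>y\<close>, and it is not everything,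
      so both the module and the quotient are smaller.\<close>
    define M where "M = (colour_rel V \<phi> i)\<^sup>* `` {x}"
    have M: "colour_module V \<phi> M" "x \<in> M" "y \<in> M"
      using gallai_component_module[OF g xy(1)] xy by (auto simp: M_def colour_rel_def)
    have MV: "M \<subseteq> V" using M by (simp add: colour_module_def)
    have "M \<noteq> V"
    proof
      assume "M = V"
      then have "(x, u) \<in> (colour_rel V \<phi> i)\<^sup>*" if "u \<in> V" for u
        using that by (auto simp: M_def)
      then show False
        using nc unfolding colour_connected_def by (meson colour_rel_rtrancl_sym rtrancl_trans)
    qed
    then have cardM: "card M < card V"
      using fin MV by (intro psubset_card_mono) auto
    have cardQ: "card (insert x (V - M)) < card V"
      using fin M xy by (intro psubset_card_mono) auto
    have QV: "insert x (V - M) \<subseteq> V" using xy by auto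
    have "CIS_d_graph d M \<phi>"
      by (rule less.hyps[OF cardM d d_graph_subset[OF dg MV] gallai_subset[OF g MV]], rule ballI,
          rule CIS_graph_module[OF bspec[OF cis] fin M(1,2)])
    moreover have "CIS_d_graph d (insert x (V - M)) \<phi>"
      by (rule less.hyps[OF cardQ d d_graph_subset[OF dg QV] gallai_subset[OF g QV]], rule ballI,
          rule CIS_graph_quotient[OF bspec[OF cis] fin M(1,2)])
    ultimately show ?thesis
      by (rule CIS_d_graph_substitution[OF M(1,2)])
  next
    case False
    define U where "U = {\<phi> {x, y} |x y. x \<in> V \<and> y \<in> V \<and> x \<noteq> y}"
    have U: "c \<in> {1..d} \<and> colour_connected V \<phi> c \<and> card V \<ge> 2" if "c \<in> U" for c
    proof -
      obtain x y where xy: "x \<in> V" "y \<in> V" "x \<noteq> y" "c = \<phi> {x, y}"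
        using \<open>c \<in> U\<close> unfolding U_def by blast
      have "card {x, y} \<le> card V"
        using fin xy by (intro card_mono) auto
      then have "card V \<ge> 2"
        using xy(3) by simp
      moreover have "c \<in> {1..d}"
        using colour_in_range[OF dg xy(1-3)] xy(4) by simp
      ultimately show ?thesis
        using False xy by metis
    qed
    have three: False if "a \<in> U" "b \<in> U" "c \<in> U" "a \<noteq> b" "a \<noteq> c" "b \<noteq> c" for a b c
      using gallai_connected_colours[OF fin _ g that(4-6)] U[OF that(1)] U[OF that(2)] U[OF that(3)]
      by blast
    have d12: "1 \<in> {1..d}" "2 \<in> {1..d}" using d by auto
    have "\<exists>i\<in>{1..d}. \<exists>j\<in>{1..d}. i \<noteq> j \<and> U \<subseteq> {i, j}"
    proof (cases "\<exists>a. a \<in> U")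
      case True
      then obtain a where a: "a \<in> U" ..
      show ?thesis
      proof (cases "\<exists>b. b \<in> U \<and> b \<noteq> a")
        case True
        then obtain b where "b \<in> U" "b \<noteq> a" by blast
        then show ?thesis using three[of a b] U a by blast
      next
        case False
        obtain b where "b \<in> {1..d}" "b \<noteq> a"
          using d12 by (metis one_eq_numeral_iff semiring_norm(85))
        then show ?thesis using False U a by blast
      qed
    next
      case False
      then show ?thesis using d12
        by (intro bexI[of _ 1] bexI[of _ 2]) auto
    qed
    then obtain i j where ij: "i \<in> {1..d}" "j \<in> {1..d}" "i \<noteq> j" "U \<subseteq> {i, j}" by blast
    have two: "\<phi> {x, y} = i \<or> \<phi> {x, y} = j" if "x \<in> V" "y \<in> V" "x \<noteq> y" for x y
    proof -
      have "\<phi> {x, y} \<in> U"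
        using that unfolding U_def by blast
      then show ?thesis using ij(4) by blast
    qed
    show ?thesis
      by (rule two_colours_CIS[OF ij(1-3) two bspec[OF cis ij(1)]])
  qed
qed

theorem proposition4p2:
  fixes d :: nat and V :: "'a set" and \<phi> :: "'a set \<Rightarrow> nat"
  assumes "d \<ge> 2" and "d_graph d V \<phi>"
  shows "CIS_d_graph d V \<phi> \<longleftrightarrow>
    gallai V \<phi> \<and> (\<forall>i\<in>{1..d}. CIS_graph V (component_edges V \<phi> i))"
proof
  assume "CIS_d_graph d V \<phi>"
  then show "gallai V \<phi> \<and> (\<forall>i\<in>{1..d}. CIS_graph V (component_edges V \<phi> i))"
    using CIS_d_graph_imp_gallai CIS_component assms(2) by blast
next
  assume "gallai V \<phi> \<and> (\<forall>i\<in>{1..d}. CIS_graph V (component_edges V \<phi> i))"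
  then show "CIS_d_graph d V \<phi>"
    using gallai_CIS_components_imp_CIS[OF assms] by blast
qed

end
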